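(* A flat virtual knot $K$ has a filamentation if and only if $p_K\equiv 0$.
   Context: A flat virtual knot $K$ is given by a Gauss codeword: a finite set of crossings and a single cyclic word in the signed letters $x^+,x^-$ ($x$ a crossing), in which, for each crossing $x$, each of $x^+$ and $x^-$ occurs exactly once. For distinct letters $x^\epsilon,y^\delta$ of the codeword, $\eta(x^\epsilon,y^\delta)$ is the number of $+$ letters minus the number of $-$ letters encountered as one cycles forward through the codeword from $x^\epsilon$ to $y^\delta$, not including these two letters. The polynomial of $K$ is $$p_K(t)=\sum_{x}\eta(x^+,x^-)\,t^{|\eta(x^+,x^-)|},$$ the sum being over all crossings $x$ of the codeword. A filamentation of $K$ is a partition of the set of crossings of the Gauss codeword into singletons (monofilaments) and pairs (bifilaments) such that for each monofilament $\{x\}$ we have $\eta(x^+,x^-)=0$, and for each bifilament $\{x,y\}$ we have $\eta(x^+,y^-)+\eta(y^+,x^-)=0$. *)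

theory Defs
  imports "HOL-Computational_Algebra.Polynomial" "HOL-Library.Disjoint_Sets"
begin

datatype 'c letter = Plus 'c | Minus 'c

primrec crossing :: "'c letter \<Rightarrow> 'c" where
  "crossing (Plus x) = x"
| "crossing (Minus x) = x"

primrec letter_sign :: "'c letter \<Rightarrow> int" where
  "letter_sign (Plus x) = 1"
| "letter_sign (Minus x) = -1"

(* The cyclic word is represented by any list obtained by cutting it open somewhere;
   the rotation lemmas below show that the choice of cut does not matter. *)
definition gauss_codeword :: "'c set \<Rightarrow> 'c letter list \<Rightarrow> bool" where
  "gauss_codeword C w \<longleftrightarrow>
     finite C \<and>
     (\<forall>a\<in>set w. crossing a \<in> C) \<and>
     (\<forall>x\<in>C. count_list w (Plus x) = 1 \<and> count_list w (Minus x) = 1)"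

definition start_at :: "'a \<Rightarrow> 'a list \<Rightarrow> 'a list" where
  "start_at a w = dropWhile (\<lambda>c. c \<noteq> a) w @ takeWhile (\<lambda>c. c \<noteq> a) w"

(* The letters strictly between a and b, reading cyclically forward from a.
   Only meaningful for distinct letters a and b of w. *)
definition between :: "'a list \<Rightarrow> 'a \<Rightarrow> 'a \<Rightarrow> 'a list" where
  "between w a b = takeWhile (\<lambda>c. c \<noteq> b) (tl (start_at a w))"

definition eta :: "'c letter list \<Rightarrow> 'c letter \<Rightarrow> 'c letter \<Rightarrow> int" where
  "eta w a b = (\<Sum>c\<leftarrow>between w a b. letter_sign c)"

definition knot_poly :: "'c set \<Rightarrow> 'c letter list \<Rightarrow> int poly" where
  "knot_poly C w =
     (\<Sum>x\<in>C. monom (eta w (Plus x) (Minus x)) (nat \<bar>eta w (Plus x) (Minus x)\<bar>))"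

definition monofilament :: "'c letter list \<Rightarrow> 'c set \<Rightarrow> bool" where
  "monofilament w B \<longleftrightarrow> (\<exists>x. B = {x} \<and> eta w (Plus x) (Minus x) = 0)"

definition bifilament :: "'c letter list \<Rightarrow> 'c set \<Rightarrow> bool" where
  "bifilament w B \<longleftrightarrow>
     (\<exists>x y. x \<noteq> y \<and> B = {x, y} \<and>
            eta w (Plus x) (Minus y) + eta w (Plus y) (Minus x) = 0)"

definition filamentation :: "'c set \<Rightarrow> 'c letter list \<Rightarrow> 'c set set \<Rightarrow> bool" where
  "filamentation C w P \<longleftrightarrow>
     partition_on C P \<and> (\<forall>B\<in>P. monofilament w B \<or> bifilament w B)"

lemma gauss_codeword_rotate1: "gauss_codeword C (rotate1 w) \<longleftrightarrow> gauss_codeword C w"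
  by (cases w) (auto simp: gauss_codeword_def)

lemma gauss_codeword_distinct:
  assumes "gauss_codeword C w"
  shows "distinct w"
proof -
  have "count_list w a = 1" if "a \<in> set w" for a
    using assms that by (cases a) (auto simp: gauss_codeword_def)
  then have "count (mset w) a = (if a \<in> set w then 1 else 0)" for a
    by (simp add: count_mset count_list_0_iff)
  then show ?thesis
    by (simp add: distinct_count_atmost_1)
qed

lemma start_at_rotate1:
  assumes "distinct w" "a \<in> set w"
  shows "start_at a (rotate1 w) = start_at a w"
proof (cases w)
  case (Cons c u)
  show ?thesis
  proof (cases "a = c")
    case True
    then have "\<forall>d\<in>set u. d \<noteq> a" using assms(1) Cons by auto
    then have "takeWhile (\<lambda>c. c \<noteq> a) (u @ [c]) = u" "dropWhile (\<lambda>c. c \<noteq> a) (u @ [c]) = [c]"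
      using True by (simp_all add: takeWhile_append2 dropWhile_append2)
    then show ?thesis using Cons True by (simp add: start_at_def)
  next
    case False
    then have "a \<in> set u" using assms(2) Cons by auto
    then show ?thesis using Cons False
      by (simp add: start_at_def takeWhile_append1[of a] dropWhile_append1[of a])
  qed
qed simp

lemma eta_rotate1:
  assumes "gauss_codeword C w" "a \<in> set w"
  shows "eta (rotate1 w) a b = eta w a b"
  using start_at_rotate1[OF gauss_codeword_distinct[OF assms(1)] assms(2)]
  by (simp add: eta_def between_def)

end

theory Submission imports Defs begin

text \<open>
  The word contains as many letters \<open>Plus\<close> as letters \<open>Minus\<close>, so the running sum of the signs
  returns to its initial value after one turn around the cyclic word. Hence \<open>eta\<close> is a
  difference of potentials: if \<open>height w a\<close> is the sum of the signs in front of \<open>a\<close>, then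
  \<open>eta w a b\<close> is the height just before \<open>b\<close> minus the height just after \<open>a\<close>, even when the
  path from \<open>a\<close> to \<open>b\<close> runs across the cut (\<open>eta_eq_height_diff\<close>). In
  \<open>eta (Plus x) (Minus y) + eta (Plus y) (Minus x)\<close> the two end points can therefore be
  exchanged: the sum equals the sum of the indices \<open>eta (Plus x) (Minus x)\<close> and
  \<open>eta (Plus y) (Minus y)\<close> of the two crossings (\<open>eta_exchange\<close>). A filamentation is thus nothing
  but a partition of the crossings into crossings of index 0 and pairs of opposite index.

  The rest concerns an arbitrary integer weight \<open>f\<close> on a finite set. The map from an integer
  \<open>k\<close> to the monomial with coefficient \<open>k\<close> and exponent \<open>\<bar>k\<bar>\<close> is odd, so every block of such
  a partition contributes 0 to the polynomial. Conversely, when the polynomial vanishes, the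
  coefficient at \<open>n > 0\<close>, which is \<open>n\<close> times the number of elements of weight \<open>n\<close> minus the
  number of elements of weight \<open>- n\<close>, is 0; so an element of nonzero weight always has a partner
  of opposite weight, and removing both leaves the polynomial unchanged.
\<close>

definition height :: "'c letter list \<Rightarrow> 'c letter \<Rightarrow> int" where
  "height w a = (\<Sum>c\<leftarrow>takeWhile (\<lambda>c. c \<noteq> a) w. letter_sign c)"

lemma set_gauss_codeword:
  assumes "gauss_codeword C w"
  shows "set w = Plus ` C \<union> Minus ` C"
proof
  show "set w \<subseteq> Plus ` C \<union> Minus ` C"
  proof
    fix a assume "a \<in> set w"
    then have "crossing a \<in> C" using assms by (simp add: gauss_codeword_def)
    then show "a \<in> Plus ` C \<union> Minus ` C" by (cases a) auto
  qed
  have "Plus x \<in> set w \<and> Minus x \<in> set w" if "x \<in> C" for x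
    using assms that by (metis count_list_0_iff gauss_codeword_def zero_neq_one)
  then show "Plus ` C \<union> Minus ` C \<subseteq> set w" by auto
qed

lemma sum_signs_gauss_codeword:
  assumes "gauss_codeword C w"
  shows "(\<Sum>c\<leftarrow>w. letter_sign c) = 0"
proof -
  have fin: "finite C" using assms by (simp add: gauss_codeword_def)
  have "(\<Sum>c\<leftarrow>w. letter_sign c) = sum letter_sign (Plus ` C \<union> Minus ` C)"
    using gauss_codeword_distinct[OF assms] set_gauss_codeword[OF assms]
    by (simp add: sum_list_distinct_conv_sum_set)
  also have "\<dots> = sum letter_sign (Plus ` C) + sum letter_sign (Minus ` C)"
    using fin by (intro sum.union_disjoint) auto
  also have "\<dots> = 0" by (simp add: sum.reindex inj_on_def)
  finally show ?thesis .
qed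

text \<open>
  If \<open>b\<close> comes after \<open>a\<close> in the list, this is telescoping. Otherwise the path from \<open>a\<close> to \<open>b\<close>
  passes the end of the list, where the running sum is 0 as at the beginning.
\<close>
lemma eta_eq_height_diff:
  assumes total: "(\<Sum>c\<leftarrow>w. letter_sign c) = 0" and "distinct w"
    and "a \<in> set w" "b \<in> set w" "a \<noteq> b"
  shows "eta w a b = height w b - (height w a + letter_sign a)"
proof -
  obtain u v where w: "w = u @ a # v" using \<open>a \<in> set w\<close> by (meson split_list)
  with \<open>distinct w\<close> have a: "a \<notin> set u" "a \<notin> set v" by auto
  then have neq: "\<And>c. c \<in> set u \<Longrightarrow> c \<noteq> a" by auto
  have start: "start_at a w = a # v @ u"
    by (simp add: start_at_def w takeWhile_append2[of u] dropWhile_append2[of u] neq)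
  have height_a: "height w a = (\<Sum>c\<leftarrow>u. letter_sign c)"
    by (simp add: height_def w takeWhile_append2[of u] neq)
  from \<open>b \<in> set w\<close> \<open>a \<noteq> b\<close> w consider "b \<in> set v" | "b \<in> set u" by auto
  then show ?thesis
  proof cases
    case 1
    then obtain v1 v2 where v: "v = v1 @ b # v2" by (meson split_list)
    have b: "\<And>c. c \<in> set v1 \<Longrightarrow> c \<noteq> b" "\<And>c. c \<in> set u \<Longrightarrow> c \<noteq> b"
      using \<open>distinct w\<close> w v by auto
    have "between w a b = v1"
      by (simp add: between_def start v takeWhile_append2[of v1] b)
    then have "eta w a b = (\<Sum>c\<leftarrow>v1. letter_sign c)"
      by (simp add: eta_def)
    moreover have "height w b = height w a + letter_sign a + (\<Sum>c\<leftarrow>v1. letter_sign c)"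
      unfolding height_a using \<open>a \<noteq> b\<close>
      by (simp add: height_def w v takeWhile_append2[of u] takeWhile_append2[of v1] b)
    ultimately show ?thesis by simp
  next
    case 2
    then obtain u1 u2 where u: "u = u1 @ b # u2" by (meson split_list)
    have b: "\<And>c. c \<in> set u1 \<Longrightarrow> c \<noteq> b" "\<And>c. c \<in> set v \<Longrightarrow> c \<noteq> b"
      using \<open>distinct w\<close> w u by auto
    have "between w a b = v @ u1"
      by (simp add: between_def start u takeWhile_append2[of v] takeWhile_append2[of u1] b)
    then have "eta w a b = (\<Sum>c\<leftarrow>v. letter_sign c) + (\<Sum>c\<leftarrow>u1. letter_sign c)"
      by (simp add: eta_def)
    moreover have "height w b = (\<Sum>c\<leftarrow>u1. letter_sign c)"
      by (simp add: height_def w u takeWhile_append2[of u1] b)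
    moreover have "(\<Sum>c\<leftarrow>u. letter_sign c) + letter_sign a + (\<Sum>c\<leftarrow>v. letter_sign c) = 0"
      using total by (simp add: w)
    ultimately show ?thesis using height_a by linarith
  qed
qed

lemma eta_exchange:
  assumes "gauss_codeword C w" "x \<in> C" "y \<in> C"
  shows "eta w (Plus x) (Minus y) + eta w (Plus y) (Minus x) =
         eta w (Plus x) (Minus x) + eta w (Plus y) (Minus y)"
proof -
  have "eta w (Plus p) (Minus q) = height w (Minus q) - (height w (Plus p) + 1)"
    if "p \<in> C" "q \<in> C" for p q
    using eta_eq_height_diff[OF sum_signs_gauss_codeword gauss_codeword_distinct, OF assms(1,1)]
      that set_gauss_codeword[OF assms(1)] by simp
  then show ?thesis using assms(2,3) by simp
qed

definition cancelling_block :: "('a \<Rightarrow> int) \<Rightarrow> 'a set \<Rightarrow> bool" where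
  "cancelling_block f B \<longleftrightarrow>
     (\<exists>x. B = {x} \<and> f x = 0) \<or> (\<exists>x y. x \<noteq> y \<and> B = {x, y} \<and> f x + f y = 0)"

lemma filamentation_iff_cancelling:
  assumes "gauss_codeword C w"
  shows "filamentation C w P \<longleftrightarrow>
    partition_on C P \<and> (\<forall>B\<in>P. cancelling_block (\<lambda>x. eta w (Plus x) (Minus x)) B)"
proof -
  have "monofilament w B \<or> bifilament w B \<longleftrightarrow>
      cancelling_block (\<lambda>x. eta w (Plus x) (Minus x)) B" if "B \<subseteq> C" for B
  proof -
    have "eta w (Plus x) (Minus y) + eta w (Plus y) (Minus x) = 0 \<longleftrightarrow>
        eta w (Plus x) (Minus x) + eta w (Plus y) (Minus y) = 0" if "B = {x, y}" for x y
      using eta_exchange[OF assms, of x y] that \<open>B \<subseteq> C\<close> by simp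
    then show ?thesis
      unfolding monofilament_def bifilament_def cancelling_block_def by (simp cong: conj_cong)
  qed
  moreover have "B \<subseteq> C" if "partition_on C P" "B \<in> P" for B
    using that by (auto simp: partition_on_def)
  ultimately show ?thesis unfolding filamentation_def by blast
qed

definition weight_monom :: "int \<Rightarrow> int poly" where
  "weight_monom k = monom k (nat \<bar>k\<bar>)"

lemma weight_monom_0 [simp]: "weight_monom 0 = 0"
  by (simp add: weight_monom_def)

lemma weight_monom_uminus: "weight_monom (- k) = - weight_monom k"
  by (simp add: weight_monom_def minus_monom)

lemma sum_weight_monom_cancelling_block:
  assumes "cancelling_block f B"
  shows "(\<Sum>x\<in>B. weight_monom (f x)) = 0"
  using assms unfolding cancelling_block_def
proof (elim disjE exE conjE)
  fix x y assume "x \<noteq> y" "B = {x, y}" "f x + f y = 0"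
  moreover from this have "f y = - f x" by simp
  ultimately show ?thesis by (simp add: weight_monom_uminus)
qed simp

text \<open>
  Without a partner, all terms of degree \<open>\<bar>f x\<bar>\<close> have the same coefficient \<open>f x\<close>, and the
  coefficient of the sum is a positive multiple of it.
\<close>
lemma opposite_weight_exists:
  assumes "finite A" "(\<Sum>x\<in>A. weight_monom (f x)) = 0" "x \<in> A" "f x \<noteq> 0"
  shows "\<exists>y\<in>A. f y = - f x"
proof (rule ccontr)
  assume none: "\<not> ?thesis"
  let ?n = "nat \<bar>f x\<bar>"
  have "0 = (\<Sum>y\<in>A. coeff (weight_monom (f y)) ?n)"
    using assms(2) by (metis coeff_0 coeff_sum)
  also have "\<dots> = (\<Sum>y\<in>A. if f y = f x then f x else 0)"
  proof (rule sum.cong)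
    fix y assume "y \<in> A"
    then have "f y \<noteq> - f x" using none by blast
    then have "nat \<bar>f y\<bar> = ?n \<longleftrightarrow> f y = f x" by linarith
    then show "coeff (weight_monom (f y)) ?n = (if f y = f x then f x else 0)"
      by (simp add: weight_monom_def)
  qed simp
  also have "\<dots> = int (card {y \<in> A. f y = f x}) * f x"
    using assms(1) by (simp add: sum.If_cases Int_def)
  finally have "card {y \<in> A. f y = f x} = 0" using assms(4) by simp
  then show False using assms(1,3) by auto
qed

lemma cancelling_partition_if_sum_zero:
  assumes "finite A" "(\<Sum>x\<in>A. weight_monom (f x)) = 0"
  shows "\<exists>P. partition_on A P \<and> (\<forall>B\<in>P. cancelling_block f B)"
  using assms
proof (induction A rule: finite_psubset_induct)
  case (psubset A)
  show ?case
  proof (cases "\<forall>x\<in>A. f x = 0")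
    case True
    then have "partition_on A ((\<lambda>x. {x}) ` A) \<and> (\<forall>B\<in>(\<lambda>x. {x}) ` A. cancelling_block f B)"
      by (auto simp: partition_on_def disjoint_def cancelling_block_def)
    then show ?thesis by blast
  next
    case False
    then obtain x where x: "x \<in> A" "f x \<noteq> 0" by blast
    then obtain y where y: "y \<in> A" "f y = - f x"
      using opposite_weight_exists[OF psubset.hyps psubset.prems] by blast
    then have "x \<noteq> y" using x by auto
    then have block: "cancelling_block f {x, y}"
      unfolding cancelling_block_def using y(2) by (intro disjI2 exI[of _ x] exI[of _ y]) simp
    have "(\<Sum>z\<in>A - {x, y}. weight_monom (f z)) = 0"
      using sum.subset_diff[of "{x, y}" A "\<lambda>z. weight_monom (f z)"]
        sum_weight_monom_cancelling_block[OF block] psubset.hyps psubset.prems x y by simp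
    then obtain P where P: "partition_on (A - {x, y}) P" "\<forall>B\<in>P. cancelling_block f B"
      using psubset.IH[of "A - {x, y}"] x by blast
    moreover have "disjnt {x, y} (\<Union>P)"
      using P(1) by (auto simp: partition_on_def disjnt_def)
    ultimately have "partition_on A (insert {x, y} P)"
      using x y by (simp add: partition_on_insert)
    then show ?thesis using P(2) block by blast
  qed
qed

lemma cancelling_partition_iff_sum_zero:
  assumes "finite A"
  shows "(\<exists>P. partition_on A P \<and> (\<forall>B\<in>P. cancelling_block f B)) \<longleftrightarrow>
    (\<Sum>x\<in>A. weight_monom (f x)) = 0"
proof
  assume "\<exists>P. partition_on A P \<and> (\<forall>B\<in>P. cancelling_block f B)"
  then obtain P where P: "partition_on A P" "\<forall>B\<in>P. cancelling_block f B" by blast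
  have "(\<Sum>x\<in>A. weight_monom (f x)) = (\<Sum>B\<in>P. \<Sum>x\<in>B. weight_monom (f x))"
    using assms P(1) by (rule sum.partition)
  also have "\<dots> = 0"
    using P(2) by (simp add: sum_weight_monom_cancelling_block)
  finally show "(\<Sum>x\<in>A. weight_monom (f x)) = 0" .
qed (rule cancelling_partition_if_sum_zero[OF assms])

theorem theoremB:
  fixes C :: "'c set" and w :: "'c letter list"
  assumes "gauss_codeword C w"
  shows "(\<exists>P. filamentation C w P) \<longleftrightarrow> knot_poly C w = 0"
proof -
  have "finite C" using assms by (simp add: gauss_codeword_def)
  then show ?thesis
    unfolding filamentation_iff_cancelling[OF assms] cancelling_partition_iff_sum_zero[OF \<open>finite C\<close>]
    by (simp add: knot_poly_def weight_monom_def)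
qed

end
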